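(* Let $m,k,d$ be nonnegative integers, $\epsilon>0$, and $s_1,\dots,s_n\in\{0,1\}^m$. Let $x\in S_{k,m}$ be such that $\mathrm{H}(x,s_i)\ge(1+\epsilon)d$ for some $i\in\{1,\dots,n\}$. Let $s^*\in S_{k,m}$ be any string with $\mathrm{H}(s^*,s_j)\le d$ for all $j=1,\dots,n$. Define \[P_0^*=\{a\in[m]: x[a]=0,\ s_i[a]=1,\ s^*[a]=1\},\qquad P_1^*=\{a\in[m]: x[a]=1,\ s_i[a]=0,\ s^*[a]=0\}.\] Then $\min(|P_0^*|,|P_1^*|)\ge \frac{\epsilon d}{2}$.
   Context: $[m]=\{1,\dots,m\}$; for a string $s\in\{0,1\}^m$, $s[a]$ is its $a$-th letter; $\mathrm{H}(x,y)$ is the Hamming distance; $S_{k,m}$ is the set of strings in $\{0,1\}^m$ with exactly $k$ ones. *)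

theory Defs
  imports Complex_Main "HOL-Library.FuncSet"
begin

text \<open>Strings in \<open>{0,1}\<^sup>m\<close> are functions on the positions \<open>{1..m}\<close>, so that
  the \<open>a\<close>-th letter of \<open>s\<close> is \<open>s a\<close>.\<close>

definition bitstrings :: "nat \<Rightarrow> (nat \<Rightarrow> nat) set" where
  "bitstrings m = {1..m} \<rightarrow>\<^sub>E {0, 1}"

definition hamming :: "nat \<Rightarrow> (nat \<Rightarrow> nat) \<Rightarrow> (nat \<Rightarrow> nat) \<Rightarrow> nat" where
  "hamming m x y = card {a \<in> {1..m}. x a \<noteq> y a}"

definition weight_strings :: "nat \<Rightarrow> nat \<Rightarrow> (nat \<Rightarrow> nat) set" where
  "weight_strings k m = {s \<in> bitstrings m. card {a \<in> {1..m}. s a = 1} = k}"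

end

theory Submission
  imports Defs
begin

text \<open>Compare the two Hamming distances position by position. At a position outside \<open>P0\<close>, the
  quantity \<open>[x \<noteq> s i] + [sstar = 1] - [x = 1]\<close> is at most \<open>[sstar \<noteq> s i]\<close>, and on \<open>P0\<close> it exceeds
  it by exactly 2. Summing, the weights cancel because \<open>x\<close> and \<open>sstar\<close> both have \<open>k\<close> ones, so the excess
  \<open>\<epsilon> * d\<close> of the distances is at most \<open>2 * card P0\<close>. For \<open>P1\<close>, exchange the roles of 0 and 1.\<close>

lemma card_filter_eq_sum:
  "finite A \<Longrightarrow> card {a \<in> A. P a} = (\<Sum>a\<in>A. if P a then 1 else 0)"
  by (simp add: sum.If_cases Int_def)

lemma bitstrings_bit: "y \<in> bitstrings m \<Longrightarrow> a \<in> {1..m} \<Longrightarrow> y a = 0 \<or> y a = 1"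
  by (auto simp: bitstrings_def PiE_iff)

text \<open>The weights of \<open>x\<close> and \<open>z\<close> stand on opposite sides rather than
  in a difference, because subtraction on \<open>nat\<close> truncates.\<close>

lemma hamming_add_weight_le:
  assumes "x \<in> bitstrings m" "y \<in> bitstrings m" "z \<in> bitstrings m"
  shows "hamming m x y + card {a \<in> {1..m}. z a = 1}
    \<le> hamming m z y + card {a \<in> {1..m}. x a = 1}
      + 2 * card {a \<in> {1..m}. x a = 0 \<and> y a = 1 \<and> z a = 1}"
    and "hamming m x y + card {a \<in> {1..m}. x a = 1}
    \<le> hamming m z y + card {a \<in> {1..m}. z a = 1}
      + 2 * card {a \<in> {1..m}. x a = 1 \<and> y a = 0 \<and> z a = 0}"
  \<comment> \<open>With each side merged into one sum over positions, comparing summands suffices: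
    three bits, hence eight cases.\<close>
  unfolding hamming_def card_filter_eq_sum[OF finite_atLeastAtMost]
    sum_distrib_left sum.distrib[symmetric]
  by (rule sum_mono; use bitstrings_bit[OF assms(1)] bitstrings_bit[OF assms(2)]
      bitstrings_bit[OF assms(3)] in fastforce)+

theorem lemma2:
  fixes m k d n i :: nat
    and \<epsilon> :: real
    and s :: "nat \<Rightarrow> nat \<Rightarrow> nat"
    and x sstar :: "nat \<Rightarrow> nat"
    and P0 P1 :: "nat set"
  assumes "\<epsilon> > 0"
    and "\<And>j. j \<in> {1..n} \<Longrightarrow> s j \<in> bitstrings m"
    and "x \<in> weight_strings k m"
    and "i \<in> {1..n}"
    and "real (hamming m x (s i)) \<ge> (1 + \<epsilon>) * real d"
    and "sstar \<in> weight_strings k m"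
    and "\<And>j. j \<in> {1..n} \<Longrightarrow> hamming m sstar (s j) \<le> d"
    and "P0 = {a \<in> {1..m}. x a = 0 \<and> s i a = 1 \<and> sstar a = 1}"
    and "P1 = {a \<in> {1..m}. x a = 1 \<and> s i a = 0 \<and> sstar a = 0}"
  shows "real (min (card P0) (card P1)) \<ge> \<epsilon> * real d / 2"
proof -
  have bits: "x \<in> bitstrings m" "s i \<in> bitstrings m" "sstar \<in> bitstrings m"
    and weights: "card {a \<in> {1..m}. x a = 1} = k" "card {a \<in> {1..m}. sstar a = 1} = k"
    using assms(2-4,6) by (auto simp: weight_strings_def)
  \<comment> \<open>Take \<open>z\<close> to be \<open>sstar\<close>: both weights equal
    \<open>k\<close> and cancel, and \<open>hamming m sstar (s i)\<close> is at most
    \<open>d\<close>.\<close>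
  have "hamming m x (s i) \<le> d + 2 * card P0" "hamming m x (s i) \<le> d + 2 * card P1"
    using hamming_add_weight_le[OF bits] assms(7)[OF assms(4)]
    unfolding weights assms(8,9) by linarith+
  then have "hamming m x (s i) \<le> d + 2 * min (card P0) (card P1)"
    by linarith
  then have "real (hamming m x (s i)) \<le> real d + 2 * real (min (card P0) (card P1))"
    by linarith
  then show ?thesis
    using assms(5) by (simp add: distrib_right)
qed

end
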